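(* Let $S=\mathbb N=\{1,2,\dots\}$ with the usual order, and let $Q$ be the transition matrix on $\mathbb N\cup\{0\}$ of a birth-and-death chain absorbed at $0$: $Q(0,0)=1$, and for $x\ge1$, $Q(x,x-1)=q_x$, $Q(x,x)=r_x$, $Q(x,x+1)=p_x$, $Q(x,y)=0$ if $|x-y|>1$, where $p_x,r_x,q_x>0$ and $q_x+r_x+p_x=1$. Assume that the chain has at least one quasi-stationary distribution and that, with the convention $p_0=0$, for every $y\ge2$, $$\frac{p_{y-1}q_y}{r_{y-1}^2+p_{y-1}q_y+q_{y-1}p_{y-2}}\le\frac{r_yq_y}{q_yr_{y-1}+r_yq_y}\le\frac{r_y^2+p_yq_{y+1}}{r_y^2+p_yq_{y+1}+q_yp_{y-1}},$$ $$\frac{p_{y-1}q_y}{r_{y-1}^2+p_{y-1}q_y+q_{y-1}p_{y-2}}\le\frac{p_{y-1}r_y}{p_{y-1}r_y+r_{y-1}p_{y-1}}\le\frac{r_y^2+p_yq_{y+1}}{r_y^2+p_yq_{y+1}+q_yp_{y-1}},$$ and $$\frac{p_1}{p_1+r_1}\le r_2+p_2,\qquad p_{y-1}\le p_y+r_y\ \text{ for all } y\ge3.$$ Then: (i) $\delta_1T_n\preccurlyeq\delta_1T_{n+1}$ for all $n\ge0$. (ii) For any probability measure $\nu$ on $\mathbb N$ and all $n\ge0$, $\delta_1T_n\preccurlyeq\nu T_n$. (iii) If $\nu$ is a quasi-stationary distribution, then $\delta_1T_n\preccurlyeq\nu$ for all $n\ge0$. (iv) The limit $\underline\nu:=\lim_n\delta_1T_n$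 exists and is a probability measure on $\mathbb N$; it is a quasi-stationary distribution and $\underline\nu\preccurlyeq\nu$ for any other quasi-stationary distribution $\nu$. Moreover, $\underline\nu=\nu_{\min}$, the minimal quasi-stationary distribution. Furthermore, for any $x\in\mathbb N$, the Yaglom limit of $\delta_x$ also converges to $\nu_{\min}$, i.e. $\lim_n\delta_xT_n=\nu_{\min}$.
   Context: $\delta_x$ is the probability measure on $\mathbb N$ concentrated at $x$, and $\preccurlyeq$ denotes the stochastic order of probability measures on $\mathbb N$ induced by the usual order. For a probability measure $\nu$ on $\mathbb N$ and $n\ge0$, $\nu T_n(y):=\frac{\nu Q^n(y)}{1-\nu Q^n(0)}$, $y\in\mathbb N$: the law at time $n$ of the chain started from $\nu$, conditioned on not being absorbed at $0$ by time $n$. A probability measure $\nu$ on $\mathbb N$ is a quasi-stationary distribution if $\nu=\nu T_1$. The Yaglom limit of $\nu$ is $\lim_n\nu T_n$, if this limit exists (pointwise) and is a probability measure. Put $a(\nu):=1-\nu Q(0)$ and $a_*:=\inf\{a(\nu):\nu\text{ is a quasi-stationary distribution}\}$. A quasi-stationary distribution $\nu$ with $a(\nu)=a_*$ is called minimal (in the sense of absorption time) and denoted $\nu_{\min}$. *)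

theory Defs
  imports "HOL-Probability.Probability"
begin

text \<open>
  The state space of the absorbed chain is \<^typ>\<open>nat\<close> with absorbing state \<open>0\<close>; the set
  \<open>{1, 2, \<dots>}\<close> of transient states is \<open>{1..}\<close>. A transition matrix \<open>Q(x, y)\<close> is a family
  \<open>Q :: nat \<Rightarrow> nat pmf\<close> of row distributions, with \<open>Q(x, y) = pmf (Q x) y\<close>, and a probability
  measure on \<open>{1, 2, \<dots>}\<close> is a \<^typ>\<open>nat pmf\<close> whose support does not contain \<open>0\<close>.
\<close>

definition prob_on_transient :: "nat pmf \<Rightarrow> bool" where
  "prob_on_transient \<nu> \<longleftrightarrow> set_pmf \<nu> \<subseteq> {1..}"

definition birth_death_chain ::
    "(nat \<Rightarrow> real) \<Rightarrow> (nat \<Rightarrow> real) \<Rightarrow> (nat \<Rightarrow> real) \<Rightarrow> (nat \<Rightarrow> nat pmf) \<Rightarrow> bool" where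
  "birth_death_chain q r p Q \<longleftrightarrow>
     pmf (Q 0) 0 = 1 \<and>
     (\<forall>x\<ge>1. p x > 0 \<and> r x > 0 \<and> q x > 0 \<and> q x + r x + p x = 1 \<and>
        pmf (Q x) (x - 1) = q x \<and> pmf (Q x) x = r x \<and> pmf (Q x) (x + 1) = p x \<and>
        (\<forall>y. \<bar>int x - int y\<bar> > 1 \<longrightarrow> pmf (Q x) y = 0))"

definition law_at :: "(nat \<Rightarrow> nat pmf) \<Rightarrow> nat \<Rightarrow> nat pmf \<Rightarrow> nat pmf" where
  "law_at Q n \<nu> = ((\<lambda>\<mu>. bind_pmf \<mu> Q) ^^ n) \<nu>"

text \<open>
  The conditioned law \<open>\<nu> T\<^sub>n\<close>. The event conditioned on has positive probability
  by lemma \<open>law_at_not_absorbed\<close>, and lemma \<open>pmf_cond_law\<close> is the formula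
  \<open>\<nu> T\<^sub>n(y) = \<nu> Q\<^sup>n(y) / (1 - \<nu> Q\<^sup>n(0))\<close>.
\<close>

definition cond_law :: "(nat \<Rightarrow> nat pmf) \<Rightarrow> nat \<Rightarrow> nat pmf \<Rightarrow> nat pmf" where
  "cond_law Q n \<nu> = cond_pmf (law_at Q n \<nu>) {1..}"

definition quasi_stationary :: "(nat \<Rightarrow> nat pmf) \<Rightarrow> nat pmf \<Rightarrow> bool" where
  "quasi_stationary Q \<nu> \<longleftrightarrow> prob_on_transient \<nu> \<and> \<nu> = cond_law Q 1 \<nu>"

definition survival :: "(nat \<Rightarrow> nat pmf) \<Rightarrow> nat pmf \<Rightarrow> real" where
  "survival Q \<nu> = 1 - pmf (law_at Q 1 \<nu>) 0"

definition min_survival :: "(nat \<Rightarrow> nat pmf) \<Rightarrow> real" where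
  "min_survival Q = Inf {survival Q \<nu> | \<nu>. quasi_stationary Q \<nu>}"

definition minimal_qsd :: "(nat \<Rightarrow> nat pmf) \<Rightarrow> nat pmf \<Rightarrow> bool" where
  "minimal_qsd Q \<nu> \<longleftrightarrow> quasi_stationary Q \<nu> \<and> survival Q \<nu> = min_survival Q"

text \<open>Stochastic order of probability measures on \<open>{1, 2, \<dots>}\<close>, by bounded increasing functions.\<close>

definition stoch_le :: "nat pmf \<Rightarrow> nat pmf \<Rightarrow> bool" (infix \<open>\<preceq>\<^sub>s\<^sub>t\<close> 50) where
  "\<mu> \<preceq>\<^sub>s\<^sub>t \<nu> \<longleftrightarrow> (\<forall>f :: nat \<Rightarrow> real. mono_on {1..} f \<longrightarrow> bounded (f ` {1..}) \<longrightarrow>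
     measure_pmf.expectation \<mu> f \<le> measure_pmf.expectation \<nu> f)"

definition yaglom_limit :: "(nat \<Rightarrow> nat pmf) \<Rightarrow> nat pmf \<Rightarrow> nat pmf \<Rightarrow> bool" where
  "yaglom_limit Q \<nu> \<mu> \<longleftrightarrow> prob_on_transient \<mu> \<and>
     (\<forall>y\<ge>1. (\<lambda>n. pmf (cond_law Q n \<nu>) y) \<longlonglongrightarrow> pmf \<mu> y)"

lemma pmf_law_at_Suc:
  "pmf (law_at Q (Suc n) \<nu>) y = (\<Sum>\<^sub>\<infinity>x. pmf (law_at Q n \<nu>) x * pmf (Q x) y)"
proof -
  have "pmf (law_at Q (Suc n) \<nu>) y = measure_pmf.expectation (law_at Q n \<nu>) (\<lambda>x. pmf (Q x) y)"
    by (simp add: law_at_def pmf_bind)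
  also have "\<dots> = (\<Sum>\<^sub>ax. pmf (law_at Q n \<nu>) x * pmf (Q x) y)"
    by (simp add: pmf_expectation_eq_infsetsum)
  also have "\<dots> = (\<Sum>\<^sub>\<infinity>x. pmf (law_at Q n \<nu>) x * pmf (Q x) y)"
    by (intro infsetsum_infsum abs_summable_on_comparison_test[OF pmf_abs_summable[of "law_at Q n \<nu>"]])
       (auto simp: mult_le_cancel_left1 pmf_le_1 mult_left_le)
  finally show ?thesis .
qed

lemma pmf_cond_law:
  assumes "pmf (law_at Q n \<nu>) 0 < 1"
  shows "pmf (cond_law Q n \<nu>) y =
    (if y = 0 then 0 else pmf (law_at Q n \<nu>) y / (1 - pmf (law_at Q n \<nu>) 0))"
proof -
  let ?M = "law_at Q n \<nu>"
  have C: "{1..} = UNIV - {0 :: nat}"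
    by auto
  have m: "measure ?M {1..} = 1 - pmf ?M 0"
    unfolding C using measure_pmf.prob_compl[of "{0}" ?M] by (simp add: measure_pmf_single)
  then have "measure ?M {1..} \<noteq> 0"
    using assms by simp
  then have "set_pmf ?M \<inter> {1..} \<noteq> {}"
    by (simp add: measure_pmf_zero_iff)
  then show ?thesis
    by (auto simp: cond_law_def pmf_cond m simp del: One_nat_def)
qed

lemma law_at_not_absorbed:
  assumes "birth_death_chain q r p Q" and "prob_on_transient \<nu>"
  shows "pmf (law_at Q n \<nu>) 0 < 1"
proof -
  obtain x where x: "x \<in> set_pmf \<nu>" "x \<ge> 1"
    using assms(2) set_pmf_not_empty[of \<nu>] by (auto simp: prob_on_transient_def)
  have "x \<in> set_pmf (Q x)"
    using assms(1) x by (auto simp: birth_death_chain_def set_pmf_iff)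
  then have "x \<in> set_pmf (law_at Q n \<nu>)"
    by (induction n) (use x in \<open>auto simp: law_at_def\<close>)
  then have "pmf (law_at Q n \<nu>) x > 0"
    by (simp add: pmf_positive)
  moreover have "pmf (law_at Q n \<nu>) 0 + pmf (law_at Q n \<nu>) x
      = measure (law_at Q n \<nu>) {0, x}"
    using x by (subst measure_measure_pmf_finite) auto
  ultimately show ?thesis
    using measure_pmf.prob_le_1[of "law_at Q n \<nu>" "{0, x}"] by linarith
qed

end

theory Submission
  imports Defs
begin

text \<open>
  Let \<open>h\<^sub>n x\<close> be the probability of surviving \<open>n\<close> steps from \<open>x\<close>. The chain conditioned to survive
  \<open>n + 1\<close> steps moves first by the kernel \<open>Q(x, y) h\<^sub>n(y) / h\<^sub>n\<^sub>+\<^sub>1(x)\<close>. These kernels are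
  stochastically monotone, by induction on \<open>n\<close>: the law of \<open>X\<^sub>1\<close> given \<open>X\<^sub>0\<close> is the equilibrium of the
  two-site heat bath that resamples \<open>X\<^sub>1\<close> given \<open>(X\<^sub>0, X\<^sub>2)\<close>, monotone by the hypotheses on bridges
  of length two, and \<open>X\<^sub>2\<close> given \<open>X\<^sub>1\<close>, monotone by the induction hypothesis. Hence \<open>\<delta>\<^sub>x T\<^sub>n\<close>
  increases with \<open>x\<close>, and \<open>\<delta>\<^sub>1 T\<^sub>n\<close> increases with \<open>n\<close> and stays below every quasi-stationary
  distribution, so it converges to a quasi-stationary distribution. By the three-term recurrence
  such a distribution is determined by its survival probability.
  The same recurrence writes \<open>\<delta>\<^sub>x Q\<^sup>n\<close> as a combination of \<open>\<delta>\<^sub>1 Q\<^sup>n\<close>, \<dots>, \<open>\<delta>\<^sub>1 Q\<^sup>n\<^sup>+\<^sup>x\<^sup>-\<^sup>1\<close>, so that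
  the convergence from \<open>1\<close> carries over to every \<open>x\<close>.
\<close>

section \<open>Expectations under conditioned and mixed laws\<close>

lemma expectation_cond_pmf:
  fixes f :: "'a \<Rightarrow> real"
  assumes "set_pmf M \<inter> S \<noteq> {}"
  shows "measure_pmf.expectation (cond_pmf M S) f
    = measure_pmf.expectation M (\<lambda>x. indicator S x * f x) / measure M S"
proof -
  have "measure_pmf.expectation (cond_pmf M S) f
      = (\<Sum>\<^sub>ax. (pmf M x * (indicator S x * f x)) * inverse (measure M S))"
    unfolding pmf_expectation_eq_infsetsum
    by (intro infsetsum_cong) (auto simp: pmf_cond[OF assms] field_simps)
  also have "\<dots> = measure_pmf.expectation M (\<lambda>x. indicator S x * f x) * inverse (measure M S)"
    unfolding pmf_expectation_eq_infsetsum infsetsum_def by (rule integral_mult_left_zero)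
  finally show ?thesis by (simp add: field_simps)
qed

lemma integrable_pmf_bounded:
  fixes f :: "'a \<Rightarrow> real"
  assumes "bounded (range f)"
  shows "integrable (measure_pmf M) f"
proof -
  obtain B where "\<And>x. \<bar>f x\<bar> \<le> B"
    using assms by (auto simp: bounded_iff)
  then show ?thesis
    by (intro measure_pmf.integrable_const_bound[of _ B]) auto
qed

lemma expectation_bind_pmf:
  fixes f :: "'b \<Rightarrow> real"
  assumes "bounded (range f)"
  shows "measure_pmf.expectation (bind_pmf M N) f
    = measure_pmf.expectation M (\<lambda>x. measure_pmf.expectation (N x) f)"
proof -
  obtain B where B: "\<And>x. \<bar>f x\<bar> \<le> B"
    using assms by (auto simp: bounded_iff)
  \<comment> \<open>Adding the bound makes the integrand nonnegative, so that the iterated integral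
    can be taken in \<open>ennreal\<close>; \<open>shift\<close> undoes it at the end.\<close>
  define g where "g x = f x + B" for x
  have g: "0 \<le> g x" "\<bar>g x\<bar> \<le> 2 * B" for x
    using B[of x] by (auto simp: g_def)
  have int_g: "integrable (measure_pmf L) g" for L
    by (rule integrable_pmf_bounded) (auto simp: bounded_iff intro!: exI[of _ "2 * B"] g)
  have E_g: "0 \<le> measure_pmf.expectation (N x) g" "measure_pmf.expectation (N x) g \<le> 2 * B" for x
    using g int_g by (auto intro!: integral_nonneg_AE measure_pmf.integral_le_const simp: abs_le_iff)
  have "ennreal (measure_pmf.expectation (bind_pmf M N) g)
      = (\<integral>\<^sup>+x. \<integral>\<^sup>+y. ennreal (g y) \<partial>N x \<partial>M)"
    by (subst nn_integral_eq_integral[symmetric]) (auto simp: int_g g)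
  also have "\<dots> = (\<integral>\<^sup>+x. ennreal (measure_pmf.expectation (N x) g) \<partial>M)"
    by (subst nn_integral_eq_integral) (auto simp: int_g g)
  also have "\<dots> = ennreal (measure_pmf.expectation M (\<lambda>x. measure_pmf.expectation (N x) g))"
    using E_g by (intro nn_integral_eq_integral integrable_pmf_bounded)
      (auto simp: bounded_iff intro!: exI[of _ "2 * B"])
  finally have eq: "measure_pmf.expectation (bind_pmf M N) g
      = measure_pmf.expectation M (\<lambda>x. measure_pmf.expectation (N x) g)"
    using g E_g by (subst (asm) ennreal_inj) (auto intro!: integral_nonneg_AE)
  have shift: "measure_pmf.expectation L g = measure_pmf.expectation L f + B" for L
    unfolding g_def using assms by (subst Bochner_Integration.integral_add)
      (auto intro: integrable_pmf_bounded)
  have "\<bar>measure_pmf.expectation (N x) f\<bar> \<le> B" for x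
    using E_g[of x] unfolding shift by linarith
  then have "bounded (range (\<lambda>x. measure_pmf.expectation (N x) f))"
    by (auto simp: bounded_iff)
  then have "measure_pmf.expectation M (\<lambda>x. measure_pmf.expectation (N x) f + B)
      = measure_pmf.expectation M (\<lambda>x. measure_pmf.expectation (N x) f) + B"
    by (subst Bochner_Integration.integral_add) (auto intro: integrable_pmf_bounded)
  then show ?thesis
    using eq by (simp add: shift)
qed

lemma expectation_indicator_pmf: "measure_pmf.expectation M (indicator {y}) = pmf M y"
  by (simp add: measure_pmf_single)

lemma bounded_range_indicator: "bounded (range (indicator A :: 'a \<Rightarrow> real))"
  by (intro boundedI[of _ 1]) (auto split: split_indicator)

lemma bounded_range_mult_indicator:
  fixes f :: "'a \<Rightarrow> real"
  assumes "bounded (f ` A)"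
  shows "bounded (range (\<lambda>x. indicator A x * f x))"
proof (rule bounded_subset)
  show "bounded (insert 0 (f ` A))"
    using assms by simp
qed (auto split: split_indicator)

section \<open>The stochastic order through tails, and its limits\<close>

lemma stoch_le_tail:
  assumes "\<mu> \<preceq>\<^sub>s\<^sub>t \<nu>"
  shows "measure \<mu> {k..} \<le> measure \<nu> {k..}"
proof -
  have "mono_on {1..} (indicator {k..} :: nat \<Rightarrow> real)"
    by (auto simp: mono_on_def split: split_indicator)
  moreover have "bounded ((indicator {k..} :: nat \<Rightarrow> real) ` {1..})"
    by (rule bounded_subset[OF bounded_range_indicator]) auto
  ultimately have "measure_pmf.expectation \<mu> (indicator {k..} :: nat \<Rightarrow> real)
      \<le> measure_pmf.expectation \<nu> (indicator {k..} :: nat \<Rightarrow> real)"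
    using assms[unfolded stoch_le_def] by (elim allE impE)
  then show ?thesis by simp
qed

lemma expectation_cong_transient:
  assumes "prob_on_transient \<nu>" "\<And>x. x \<ge> 1 \<Longrightarrow> f x = g x"
  shows "measure_pmf.expectation \<nu> f = measure_pmf.expectation \<nu> g"
  using assms by (intro integral_cong_AE) (auto simp: AE_measure_pmf_iff prob_on_transient_def)

lemma expectation_truncation_tendsto:
  fixes f :: "nat \<Rightarrow> real"
  assumes "prob_on_transient \<nu>" "bounded (f ` {1..})"
  shows "(\<lambda>N. measure_pmf.expectation \<nu> (\<lambda>x. f (min x (Suc N)))) \<longlonglongrightarrow> measure_pmf.expectation \<nu> f"
proof -
  obtain B where B: "\<And>x. x \<ge> 1 \<Longrightarrow> \<bar>f x\<bar> \<le> B"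
    using assms(2) by (auto simp: bounded_iff)
  show ?thesis
  proof (rule integral_dominated_convergence[where w="\<lambda>_. B"])
    have "(\<lambda>N. f (min x (Suc N))) \<longlonglongrightarrow> f x" for x
      by (rule tendsto_eventually) (auto simp: eventually_sequentially min_def intro!: exI[of _ x])
    then show "AE x in \<nu>. (\<lambda>N. f (min x (Suc N))) \<longlonglongrightarrow> f x"
      by simp
    show "AE x in \<nu>. norm (f (min x (Suc N))) \<le> B" for N
      using assms(1) B by (auto simp: AE_measure_pmf_iff prob_on_transient_def)
  qed auto
qed

text \<open>Raising the level at which \<open>f\<close> is truncated by one adds a tail indicator
  times an increment of \<open>f\<close>, which is nonnegative. So truncations are handled by
  induction, and dominated convergence removes the truncation.\<close>

lemma stoch_leI_tail:
  assumes trans: "prob_on_transient \<mu>" "prob_on_transient \<nu>"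
    and tail: "\<And>k. measure \<mu> {k..} \<le> measure \<nu> {k..}"
  shows "\<mu> \<preceq>\<^sub>s\<^sub>t \<nu>"
  unfolding stoch_le_def
proof (intro allI impI)
  fix f :: "nat \<Rightarrow> real"
  assume mono: "mono_on {1..} f" and bdd: "bounded (f ` {1..})"
  have "measure_pmf.expectation \<mu> (\<lambda>x. f (min x (Suc N)))
      \<le> measure_pmf.expectation \<nu> (\<lambda>x. f (min x (Suc N)))" for N
  proof (induction N)
    case 0
    have "measure_pmf.expectation L (\<lambda>x. f (min x (Suc 0))) = f 1" if "prob_on_transient L" for L
      using expectation_cong_transient[OF that, of "\<lambda>x. f (min x (Suc 0))" "\<lambda>_. f 1"] by simp
    then show ?case
      using trans by simp
  next
    case (Suc N)
    let ?d = "f (Suc (Suc N)) - f (Suc N)"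
    have d: "?d \<ge> 0"
      using mono by (auto simp: mono_on_def)
    have "measure_pmf.expectation L (\<lambda>x. f (min x (Suc (Suc N))))
        = measure_pmf.expectation L (\<lambda>x. f (min x (Suc N))) + ?d * measure L {Suc (Suc N)..}" for L
    proof -
      have "bounded (range (\<lambda>x. f (min x (Suc N))))"
        by (rule finite_imp_bounded, rule finite_subset[of _ "f ` {..Suc N}"]) auto
      then have "measure_pmf.expectation L (\<lambda>x. f (min x (Suc N)) + ?d * indicator {Suc (Suc N)..} x)
          = measure_pmf.expectation L (\<lambda>x. f (min x (Suc N))) + ?d * measure L {Suc (Suc N)..}"
        by (subst Bochner_Integration.integral_add)
          (auto intro!: integrable_pmf_bounded bounded_range_indicator)
      also have "(\<lambda>x. f (min x (Suc N)) + ?d * indicator {Suc (Suc N)..} x)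
          = (\<lambda>x. f (min x (Suc (Suc N))))"
      proof
        fix x
        show "f (min x (Suc N)) + ?d * indicator {Suc (Suc N)..} x = f (min x (Suc (Suc N)))"
          by (cases "x \<le> Suc N") (simp_all add: min_absorb1 min_absorb2)
      qed
      finally show ?thesis .
    qed
    then show ?case
      using Suc.IH mult_left_mono[OF tail d] by (simp add: add_mono)
  qed
  then show "measure_pmf.expectation \<mu> f \<le> measure_pmf.expectation \<nu> f"
    by (intro LIMSEQ_le[OF expectation_truncation_tendsto[OF trans(1) bdd]
          expectation_truncation_tendsto[OF trans(2) bdd]]) auto
qed

lemma measure_pmf_atLeast_nat: "measure (measure_pmf \<nu>) {k..} = 1 - (\<Sum>i<k. pmf \<nu> i)" for k :: nat
proof -
  have "{k..} = UNIV - {..<k}"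
    by auto
  then show ?thesis
    using measure_pmf.prob_compl[of "{..<k}" \<nu>] by (simp add: measure_measure_pmf_finite)
qed

lemma stoch_le_limit:
  assumes "\<And>y. (\<lambda>n. pmf (\<mu> n) y) \<longlonglongrightarrow> pmf \<mu>' y" "\<And>n. \<mu> n \<preceq>\<^sub>s\<^sub>t \<nu>"
    "prob_on_transient \<mu>'" "prob_on_transient \<nu>"
  shows "\<mu>' \<preceq>\<^sub>s\<^sub>t \<nu>"
proof (rule stoch_leI_tail)
  fix k
  have "(\<lambda>n. measure (\<mu> n) {k..}) \<longlonglongrightarrow> measure \<mu>' {k..}"
    unfolding measure_pmf_atLeast_nat by (intro tendsto_intros assms)
  then show "measure \<mu>' {k..} \<le> measure \<nu> {k..}"
    by (rule LIMSEQ_le_const2) (use stoch_le_tail[OF assms(2)] in auto)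
qed (use assms in auto)

lemma pmf_0_transient: "prob_on_transient \<nu> \<Longrightarrow> pmf \<nu> 0 = 0"
  by (auto simp: prob_on_transient_def set_pmf_iff)

text \<open>Tails increase in \<open>n\<close>, so they converge, and point masses converge as their
  differences. The common bound \<open>\<nu>\<close> gives tightness: the limiting tails vanish at
  infinity, so no mass escapes.\<close>

lemma stoch_increasing_convergent:
  assumes trans: "\<And>n. prob_on_transient (\<mu> n)"
    and inc: "\<And>n. \<mu> n \<preceq>\<^sub>s\<^sub>t \<mu> (Suc n)" and bound: "\<And>n. \<mu> n \<preceq>\<^sub>s\<^sub>t \<nu>"
  obtains \<mu>' where "prob_on_transient \<mu>'" "\<And>y. (\<lambda>n. pmf (\<mu> n) y) \<longlonglongrightarrow> pmf \<mu>' y"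
proof -
  define t where "t k = lim (\<lambda>n. measure (\<mu> n) {k..})" for k
  have t: "(\<lambda>n. measure (\<mu> n) {k..}) \<longlonglongrightarrow> t k" for k
  proof -
    have "incseq (\<lambda>n. measure (\<mu> n) {k..})"
      by (intro incseq_SucI stoch_le_tail inc)
    then have "convergent (\<lambda>n. measure (\<mu> n) {k..})"
      by (rule incseq_convergent[of _ 1]) (auto intro: convergentI)
    then show ?thesis
      by (simp add: t_def convergent_LIMSEQ_iff)
  qed
  have t_lim: "t \<longlonglongrightarrow> 0"
  proof (rule tendsto_sandwich)
    show "eventually (\<lambda>k. 0 \<le> t k) sequentially"
      by (intro always_eventually allI LIMSEQ_le_const[OF t]) auto
    show "eventually (\<lambda>k. t k \<le> measure \<nu> {k..}) sequentially"
      by (intro always_eventually allI LIMSEQ_le_const2[OF t]) (auto intro: stoch_le_tail bound)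
    have "(\<lambda>k. measure \<nu> {k..}) \<longlonglongrightarrow> measure \<nu> (\<Inter>k. {k..})"
      by (rule measure_pmf.finite_Lim_measure_decseq) (auto simp: decseq_def)
    also have "(\<Inter>k. {k..}) = ({} :: nat set)"
      using Suc_n_not_le_n by blast
    finally show "(\<lambda>k. measure \<nu> {k..}) \<longlonglongrightarrow> 0"
      by simp
  qed auto
  define f where "f y = t y - t (Suc y)" for y
  have f: "(\<lambda>n. pmf (\<mu> n) y) \<longlonglongrightarrow> f y" for y
    using tendsto_diff[OF t[of y] t[of "Suc y"]]
    by (simp add: f_def measure_pmf_atLeast_nat)
  have f_nonneg: "f y \<ge> 0" for y
    by (rule LIMSEQ_le_const[OF f]) auto
  have "t 0 = 1"
    using t[of 0] by (simp add: measure_pmf_atLeast_nat LIMSEQ_const_iff)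
  \<comment> \<open>The total mass telescopes to \<open>t 0\<close> minus the limit of
    \<open>t\<close>.\<close>
  then have "f sums 1"
    using telescope_sums'[OF t_lim] by (simp add: f_def[abs_def])
  then have total: "(\<integral>\<^sup>+y. ennreal (f y) \<partial>count_space UNIV) = 1"
    using suminf_ennreal_eq[OF f_nonneg] by (simp add: nn_integral_count_space_nat)
  have pmf: "pmf (embed_pmf f) y = f y" for y
    using pmf_embed_pmf[OF f_nonneg total] .
  have "f 0 = 0"
    using f[of 0] by (simp add: pmf_0_transient trans LIMSEQ_const_iff)
  then have "prob_on_transient (embed_pmf f)"
    using pmf[of 0] by (auto simp: prob_on_transient_def set_pmf_iff Suc_le_eq intro: gr0I)
  then show ?thesis
    using that f by (simp add: pmf)
qed

section \<open>The heat bath comparison as an inequality between reals\<close>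

text \<open>
  The indices \<open>1\<close> and \<open>2\<close> stand for two adjacent states; \<open>B0\<close>, \<open>B1\<close> and \<open>C0\<close>, \<open>C1\<close> are the
  probabilities that the midpoint of a two-step bridge is at least \<open>2\<close>, for bridges that start at
  \<open>1\<close> and at \<open>2\<close> respectively and end at \<open>1\<close> or \<open>2\<close>. \<open>W\<close> and \<open>V\<close> are the two rates at which
  the heat bath moves the midpoint across the gap.
\<close>

lemma heat_bath_comparison:
  fixes p0 q1 r1 p1 q2 r2 p2 q3 g1 g2 h0 h1 h2 h3 B0 B1 C0 C1 :: real
  assumes pos: "q1 \<ge> 0" "r1 > 0" "p1 > 0" "q2 > 0" "r2 > 0" "p2 \<ge> 0"
    and g: "g1 > 0" "g2 > 0" and h: "h0 \<ge> 0" "h1 > 0" "h2 > 0" "h3 \<ge> 0"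
    and B0: "B0 * (r1^2 + p1*q2 + q1*p0) = p1*q2"
    and B1: "B1 * (p1*r2 + r1*p1) = p1*r2"
    and C0: "C0 * (q2*r1 + r2*q2) = r2*q2"
    and C1: "C1 * (r2^2 + p2*q3 + q2*p1) = r2^2 + p2*q3"
    and le: "0 \<le> B0" "B0 \<le> C0" "C0 \<le> C1" "B0 \<le> B1" "B1 \<le> C1" "C1 \<le> 1" "0 < C0" "B0 < 1"
    and K0: "p0 * g1 * h1 \<le> (r1*g1 + p1*g2) * h0"
    and K2: "q3 * g2 * h2 \<le> (q2*g1 + r2*g2) * h3"
  shows "p1*h2 * (q2*h1) \<le> (r2*h2 + p2*h3) * (q1*h0 + r1*h1)"
proof -
  \<comment> \<open>\<open>W\<close> moves a midpoint from \<open>1\<close> up for bridges started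
    at \<open>2\<close>, \<open>V\<close> one from \<open>2\<close> down for bridges started at
    \<open>1\<close>; the rates are \<open>W / h1\<close> and \<open>V / h2\<close>. Only the
    endpoints \<open>1\<close> and \<open>2\<close> contribute, as any other endpoint forces the
    midpoint.\<close>
  define W where "W = C0*r1*g1 + C1*p1*g2"
  define V where "V = (1-B0)*q2*g1 + (1-B1)*r2*g2"
  have W: "W > 0"
    unfolding W_def using pos g le by (intro add_pos_nonneg mult_pos_pos mult_nonneg_nonneg) auto
  have V: "V > 0"
    unfolding V_def using pos g le by (intro add_pos_nonneg mult_pos_pos mult_nonneg_nonneg) auto
  \<comment> \<open>Balance of flow across the gap for the start \<open>1\<close>: moves down from
    \<open>2\<close> equal moves up from \<open>1\<close> and from \<open>0\<close>. Then
    \<open>K0\<close> bounds the flow from \<open>0\<close>, comparing the next state after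
    \<open>0\<close> with that after \<open>1\<close>.\<close>
  have "p1 * V = (p1*q2 - B0 * (p1*q2)) * g1 + (p1*r2 - B1 * (p1*r2)) * g2"
    by (simp add: V_def algebra_simps)
  also have "p1*q2 - B0 * (p1*q2) = B0 * (r1^2 + q1*p0)"
    using B0 by (simp add: algebra_simps)
  also have "p1*r2 - B1 * (p1*r2) = B1 * (r1*p1)"
    using B1 by (simp add: algebra_simps)
  finally have V_eq: "p1 * V * h1 = r1*h1 * (B0*r1*g1 + B1*p1*g2) + q1 * B0 * (p0*g1*h1)"
    by (simp add: algebra_simps power2_eq_square)
  have BW: "B0*r1*g1 + B1*p1*g2 \<le> W" "B0 * (r1*g1 + p1*g2) \<le> W"
    unfolding W_def ring_distribs mult.assoc
    using pos g le by (intro add_mono mult_right_mono; simp)+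
  have "q1 * B0 * (p0*g1*h1) \<le> q1 * B0 * ((r1*g1 + p1*g2) * h0)"
    using pos le K0 by (intro mult_left_mono) auto
  also have "\<dots> = q1 * h0 * (B0 * (r1*g1 + p1*g2))"
    by simp
  also have "\<dots> \<le> q1 * h0 * W"
    using pos h BW by (intro mult_left_mono) auto
  finally have up: "p1 * V * h1 \<le> (q1*h0 + r1*h1) * W"
    using V_eq mult_left_mono[OF BW(1), of "r1*h1"] pos h by (simp add: algebra_simps)
  \<comment> \<open>The mirror image for the start \<open>2\<close>, with \<open>K2\<close> bounding
    the flow down from \<open>3\<close>.\<close>
  have "q2 * W = (C0 * (q2*r1)) * g1 + (C1 * (q2*p1)) * g2"
    by (simp add: W_def algebra_simps)
  also have "C0 * (q2*r1) = (1-C0) * r2 * q2"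
    using C0 by (simp add: algebra_simps)
  also have "C1 * (q2*p1) = (1-C1) * (r2^2 + p2*q3)"
    using C1 by (simp add: algebra_simps)
  finally have W_eq: "q2 * W * h2 = r2*h2 * ((1-C0)*q2*g1 + (1-C1)*r2*g2) + p2 * (1-C1) * (q3*g2*h2)"
    by (simp only: power2_eq_square) (simp only: ring_distribs ac_simps)
  have CV: "(1-C0)*q2*g1 + (1-C1)*r2*g2 \<le> V" "(1-C1) * (q2*g1 + r2*g2) \<le> V"
    unfolding V_def distrib_left mult.assoc
    using pos g le by (intro add_mono mult_right_mono; simp)+
  have "p2 * (1-C1) * (q3*g2*h2) \<le> p2 * (1-C1) * ((q2*g1 + r2*g2) * h3)"
    using pos le K2 by (intro mult_left_mono) auto
  also have "\<dots> = p2 * h3 * ((1-C1) * (q2*g1 + r2*g2))"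
    by simp
  also have "\<dots> \<le> p2 * h3 * V"
    using pos h CV by (intro mult_left_mono) auto
  finally have down: "q2 * W * h2 \<le> (r2*h2 + p2*h3) * V"
    using W_eq mult_left_mono[OF CV(1), of "r2*h2"] pos h by (simp add: algebra_simps)
  \<comment> \<open>\<open>up\<close> and \<open>down\<close> compare the odds of a midpoint at
    least \<open>2\<close>, for the starts \<open>1\<close> and \<open>2\<close>, with the same
    number \<open>W * h2 / (V * h1)\<close>.\<close>
  have "(p1 * V * h1) * (q2 * W * h2) \<le> ((q1*h0 + r1*h1) * W) * ((r2*h2 + p2*h3) * V)"
    by (intro mult_mono[OF up down]) (use pos h W V in auto)
  then have "(p1*h2 * (q2*h1)) * (V*W) \<le> ((r2*h2 + p2*h3) * (q1*h0 + r1*h1)) * (V*W)"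
    by (simp add: algebra_simps)
  then show ?thesis
    using V W by simp
qed

section \<open>Transition operator, survival functions and conditioned laws\<close>

locale absorbed_birth_death =
  fixes q r p :: "nat \<Rightarrow> real" and Q :: "nat \<Rightarrow> nat pmf"
  assumes chain: "birth_death_chain q r p Q"
begin

lemma rates:
  assumes "x \<ge> 1"
  shows "p x > 0" "r x > 0" "q x > 0" "q x + r x + p x = 1"
  using chain assms by (auto simp: birth_death_chain_def)

lemma rates_Suc:
  "p (Suc x) > 0" "r (Suc x) > 0" "q (Suc x) > 0" "q (Suc x) + r (Suc x) + p (Suc x) = 1"
  by (simp_all add: rates)

lemma Q_0: "Q 0 = return_pmf 0"
proof -
  have "pmf (Q 0) 0 = 1"
    using chain by (simp add: birth_death_chain_def)
  then have "measure (Q 0) {0} = 1"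
    by (simp add: measure_pmf_single)
  then have "set_pmf (Q 0) \<subseteq> {0}"
    by (subst (asm) measure_pmf.prob_eq_1) (auto simp: AE_measure_pmf_iff)
  then show ?thesis
    by (simp add: set_pmf_subset_singleton)
qed

definition step :: "(nat \<Rightarrow> real) \<Rightarrow> nat \<Rightarrow> real" where
  "step f x = measure_pmf.expectation (Q x) f"

lemma step_0: "step f 0 = f 0"
  by (simp add: step_def Q_0)

lemma step_Suc:
  "step f (Suc x) = q (Suc x) * f x + r (Suc x) * f (Suc x) + p (Suc x) * f (Suc (Suc x))"
proof -
  have Q: "pmf (Q (Suc x)) x = q (Suc x)" "pmf (Q (Suc x)) (Suc x) = r (Suc x)"
    "pmf (Q (Suc x)) (Suc (Suc x)) = p (Suc x)"
    "\<And>y. \<bar>int (Suc x) - int y\<bar> > 1 \<Longrightarrow> pmf (Q (Suc x)) y = 0"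
    using chain[unfolded birth_death_chain_def, THEN conjunct2, rule_format, of "Suc x"] by auto
  have "step f (Suc x) = (\<Sum>y\<in>{x, Suc x, Suc (Suc x)}. f y * pmf (Q (Suc x)) y)"
    unfolding step_def
  proof (rule integral_measure_pmf_real)
    fix y assume "y \<in> set_pmf (Q (Suc x))"
    then have "\<not> \<bar>int (Suc x) - int y\<bar> > 1"
      using Q(4) by (auto simp: set_pmf_iff)
    then show "y \<in> {x, Suc x, Suc (Suc x)}"
      by auto
  qed auto
  then show ?thesis
    by (simp add: Q)
qed

lemma bounded_step: "bounded (range f) \<Longrightarrow> bounded (range (step f))"
proof -
  assume b: "bounded (range f)"
  then obtain B where B: "\<And>x. \<bar>f x\<bar> \<le> B"
    by (auto simp: bounded_iff)
  have "\<bar>step f x\<bar> \<le> B" for x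
  proof -
    have "step f x \<le> B" "-B \<le> step f x" unfolding step_def
      using B b by (auto intro!: measure_pmf.integral_le_const measure_pmf.integral_ge_const
          integrable_pmf_bounded simp: abs_le_iff minus_le_iff)
    then show ?thesis by simp
  qed
  then show ?thesis
    by (auto simp: bounded_iff)
qed

lemma bounded_steps: "bounded (range f) \<Longrightarrow> bounded (range ((step ^^ n) f))"
  by (induction n) (auto intro: bounded_step)

lemma expectation_law_at:
  assumes "bounded (range f)"
  shows "measure_pmf.expectation (law_at Q n \<nu>) f = measure_pmf.expectation \<nu> ((step ^^ n) f)"
  using assms
proof (induction n arbitrary: f)
  case 0
  show ?case by (simp add: law_at_def)
next
  case (Suc n)
  have "measure_pmf.expectation (law_at Q (Suc n) \<nu>) f
      = measure_pmf.expectation (law_at Q n \<nu>) (step f)"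
    by (simp add: step_def[abs_def] law_at_def expectation_bind_pmf Suc.prems)
  also have "\<dots> = measure_pmf.expectation \<nu> ((step ^^ n) (step f))"
    by (rule Suc.IH[OF bounded_step[OF Suc.prems]])
  finally show ?case
    by (simp add: funpow_swap1)
qed

lemma steps_0: "(step ^^ n) f 0 = f 0"
  by (induction n) (auto simp: step_0)

definition surv :: "nat \<Rightarrow> nat \<Rightarrow> real" where
  "surv n = (step ^^ n) (indicator {1..})"

lemma bounded_surv: "bounded (range (surv n))"
  unfolding surv_def by (intro bounded_steps bounded_range_indicator)

lemma surv_0: "surv n 0 = 0"
  by (simp add: surv_def steps_0)

lemma surv_pos: "x \<ge> 1 \<Longrightarrow> surv n x > 0"
proof (induction n arbitrary: x)
  case 0
  then show ?case by (simp add: surv_def)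
next
  case (Suc n)
  then obtain z where x: "x = Suc z"
    by (cases x) auto
  have "q (Suc z) * surv n z \<ge> 0" "r (Suc z) * surv n (Suc z) > 0"
    "p (Suc z) * surv n (Suc (Suc z)) > 0"
    using Suc.IH[of z] Suc.IH[of "Suc z"] Suc.IH[of "Suc (Suc z)"] rates_Suc[of z] surv_0[of n]
    by (cases z; auto intro!: mult_nonneg_nonneg)+
  then show ?case
    by (simp add: surv_def x step_Suc)
qed

lemma expectation_surv_pos:
  assumes "prob_on_transient \<nu>"
  shows "measure_pmf.expectation \<nu> (surv n) > 0"
proof -
  obtain x where x: "x \<in> set_pmf \<nu>" "x \<ge> 1"
    using assms set_pmf_not_empty[of \<nu>] by (auto simp: prob_on_transient_def)
  have nn: "surv n y \<ge> 0" for y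
    using surv_pos[of y n] surv_0[of n] by (cases y) auto
  have "0 < surv n x * pmf \<nu> x"
    using surv_pos[OF x(2)] x by (simp add: pmf_positive)
  also have "\<dots> = measure_pmf.expectation \<nu> (\<lambda>y. indicator {x} y * surv n y)"
    by (subst integral_measure_pmf_real[of "{x}"]) (auto split: split_indicator_asm)
  also have "\<dots> \<le> measure_pmf.expectation \<nu> (surv n)"
    by (intro integral_mono integrable_pmf_bounded bounded_surv bounded_range_mult_indicator
        bounded_subset[OF bounded_surv]) (auto simp: nn split: split_indicator)
  finally show ?thesis .
qed

lemma set_law_at_transient:
  assumes "prob_on_transient \<nu>"
  shows "set_pmf (law_at Q n \<nu>) \<inter> {1..} \<noteq> {}"
proof
  assume "set_pmf (law_at Q n \<nu>) \<inter> {1..} = {}"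
  then have "set_pmf (law_at Q n \<nu>) \<subseteq> {0}"
    by (auto simp: Int_def Suc_le_eq)
  then have "law_at Q n \<nu> = return_pmf 0"
    by (simp add: set_pmf_subset_singleton)
  then show False
    using law_at_not_absorbed[OF chain assms, of n] by simp
qed

lemma prob_on_transient_cond_law:
  assumes "prob_on_transient \<nu>"
  shows "prob_on_transient (cond_law Q n \<nu>)"
  unfolding prob_on_transient_def cond_law_def
  using set_cond_pmf[OF set_law_at_transient[OF assms]] by simp

text \<open>As \<open>f\<close> vanishes at the absorbing state, conditioning only divides by the
  mass of \<open>{1..}\<close>; duality between laws and \<open>step\<close> moves numerator and
  denominator back to \<open>\<nu>\<close>.\<close>

lemma expectation_cond_law:
  assumes "prob_on_transient \<nu>" "bounded (range f)" "f 0 = 0"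
  shows "measure_pmf.expectation (cond_law Q n \<nu>) f
    = measure_pmf.expectation \<nu> ((step ^^ n) f) / measure_pmf.expectation \<nu> (surv n)"
proof -
  have f: "(\<lambda>x. indicator {1..} x * f x) = f"
    using assms(3) by (auto simp: fun_eq_iff Suc_le_eq split: split_indicator)
  have "measure (law_at Q n \<nu>) {1..} = measure_pmf.expectation (law_at Q n \<nu>) (indicator {1..})"
    by simp
  also have "\<dots> = measure_pmf.expectation \<nu> (surv n)"
    unfolding surv_def by (intro expectation_law_at bounded_range_indicator)
  finally show ?thesis
    unfolding cond_law_def expectation_cond_pmf[OF set_law_at_transient[OF assms(1)]] f
    by (simp add: expectation_law_at assms)
qed

lemma pmf_cond_law_eq:
  assumes "prob_on_transient \<nu>" "y \<ge> 1"
  shows "pmf (cond_law Q n \<nu>) y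
    = measure_pmf.expectation \<nu> ((step ^^ n) (indicator {y})) / measure_pmf.expectation \<nu> (surv n)"
  unfolding expectation_indicator_pmf[symmetric]
  using assms by (intro expectation_cond_law bounded_range_indicator) auto

lemma pmf_eqI_transient:
  assumes "prob_on_transient \<mu>" "prob_on_transient \<nu>" "\<And>y. y \<ge> 1 \<Longrightarrow> pmf \<mu> y = pmf \<nu> y"
  shows "\<mu> = \<nu>"
proof (rule pmf_eqI)
  fix y show "pmf \<mu> y = pmf \<nu> y"
    using assms by (cases "y = 0") (auto simp: pmf_0_transient)
qed

text \<open>Conditioning at the intermediate time divides numerator and denominator by the same
  survival mass, which cancels.\<close>

lemma cond_law_add:
  assumes "prob_on_transient \<nu>"
  shows "cond_law Q n (cond_law Q m \<nu>) = cond_law Q (m + n) \<nu>"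
proof (rule pmf_eqI_transient)
  fix y :: nat assume y: "y \<ge> 1"
  have *: "measure_pmf.expectation (cond_law Q m \<nu>) ((step ^^ n) f)
      = measure_pmf.expectation \<nu> ((step ^^ (m + n)) f) / measure_pmf.expectation \<nu> (surv m)"
    if "bounded (range f)" "f 0 = 0" for f
    using that by (subst expectation_cond_law)
      (auto simp: assms steps_0 funpow_add intro: bounded_steps)
  show "pmf (cond_law Q n (cond_law Q m \<nu>)) y = pmf (cond_law Q (m + n) \<nu>) y"
    unfolding pmf_cond_law_eq[OF prob_on_transient_cond_law[OF assms] y]
      pmf_cond_law_eq[OF assms y] surv_def[of n] surv_def[of "m + n"]
    using y expectation_surv_pos[OF assms, of m]
    by (subst (1 2) *) (auto intro: bounded_range_indicator)
qed (auto intro: prob_on_transient_cond_law assms)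

lemma cond_law_quasi_stationary:
  assumes "quasi_stationary Q \<nu>"
  shows "cond_law Q n \<nu> = \<nu>"
proof (induction n)
  case 0
  have t: "prob_on_transient \<nu>"
    using assms by (simp add: quasi_stationary_def)
  \<comment> \<open>Time \<open>0\<close> is covered by applying \<open>cond_law Q 0\<close> to
    \<open>\<nu> = cond_law Q 1 \<nu>\<close>.\<close>
  show ?case
    using cond_law_add[OF t, of 0 1] assms by (simp add: quasi_stationary_def)
next
  case (Suc n)
  then show ?case
    using cond_law_add[of \<nu> n 1] assms by (simp add: quasi_stationary_def)
qed

section \<open>Monotone kernels and comparison of starting laws\<close>

text \<open>
  For the kernel \<open>K(x, y) = Q(x, y) h(y) / step h x\<close> this says
  \<open>K(x + 1, {x + 2..}) \<le> K(x + 2, {x + 2..})\<close>, cleared of denominators and of the terms that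
  occur on both sides.
\<close>

definition kernel_mono :: "(nat \<Rightarrow> real) \<Rightarrow> bool" where
  "kernel_mono h \<longleftrightarrow> (\<forall>x. p (Suc x) * h (Suc (Suc x)) * (q (Suc (Suc x)) * h (Suc x))
    \<le> (r (Suc (Suc x)) * h (Suc (Suc x)) + p (Suc (Suc x)) * h (Suc (Suc (Suc x))))
      * (q (Suc x) * h x + r (Suc x) * h (Suc x)))"

lemma kernel_monoD:
  assumes "kernel_mono h"
  shows "p (Suc x) * h (Suc (Suc x)) * (q (Suc (Suc x)) * h (Suc x))
    \<le> (r (Suc (Suc x)) * h (Suc (Suc x)) + p (Suc (Suc x)) * h (Suc (Suc (Suc x))))
      * (q (Suc x) * h x + r (Suc x) * h (Suc x))"
  using assms by (simp add: kernel_mono_def)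

text \<open>The ratio is the expectation of \<open>F\<close> at time \<open>n\<close> from
  \<open>x\<close> given survival. One more step averages the previous ratio against the kernel of
  \<open>surv n\<close>, which is monotone by \<open>h\<close>.\<close>

lemma ratio_mono:
  assumes h: "\<And>n. kernel_mono (surv n)" and F: "F 0 = 0" and mono: "mono_on {1..} F"
  shows "mono_on {1..} (\<lambda>x. (step ^^ n) F x / surv n x)"
proof -
  have Suc_le: "(step ^^ n) F (Suc x) / surv n (Suc x)
      \<le> (step ^^ n) F (Suc (Suc x)) / surv n (Suc (Suc x))" for x
  proof (induction n arbitrary: x)
    case 0
    show ?case
      using mono by (auto simp: surv_def mono_on_def)
  next
    case (Suc n)
    let ?x1 = "Suc x" let ?x2 = "Suc ?x1" let ?x3 = "Suc ?x2"
    define \<phi> where "\<phi> y = (step ^^ n) F y / surv n y" for y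
    \<comment> \<open>At \<open>0\<close> the quotient is a division by \<open>0\<close>, but there
      both \<open>surv n\<close> and \<open>(step ^^ n) F\<close> vanish.\<close>
    have G: "(step ^^ n) F y = \<phi> y * surv n y" for y
      using surv_pos[of y n] surv_0[of n] steps_0[of n F] F by (cases "y = 0") (auto simp: \<phi>_def)
    have \<phi>: "\<phi> ?x1 \<le> \<phi> ?x2" "\<phi> ?x2 \<le> \<phi> ?x3"
      unfolding \<phi>_def by (rule Suc.IH)+
    \<comment> \<open>Moving the mass at \<open>x\<close> up to \<open>?x1\<close>, and that at
      \<open>?x3\<close> down to \<open>?x2\<close>, leaves two averages over \<open>?x1\<close> and
      \<open>?x2\<close>, with weights \<open>A\<close>, \<open>U\<close> and \<open>D\<close>,
      \<open>C\<close>. Their comparison is \<open>U * D \<le> C * A\<close>, that is,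
      \<open>kernel_mono\<close>.\<close>
    define A where "A = q ?x1 * surv n x + r ?x1 * surv n ?x1"
    define U where "U = p ?x1 * surv n ?x2"
    define D where "D = q ?x2 * surv n ?x1"
    define C where "C = r ?x2 * surv n ?x2 + p ?x2 * surv n ?x3"
    have pos: "surv n ?x1 > 0" "surv n ?x2 > 0" "surv n ?x3 > 0" "surv n x \<ge> 0"
      using surv_pos[of x n] surv_0[of n] by (auto intro: surv_pos) (cases x; auto)
    have "A > 0"
      unfolding A_def using pos rates_Suc[of x] by (intro add_nonneg_pos) auto
    moreover have "C > 0" "U > 0" "D > 0"
      unfolding C_def U_def D_def using pos rates_Suc by (auto intro!: add_pos_pos)
    ultimately have ACUD: "A > 0" "C > 0" "U > 0" "D > 0" .
    have UD: "U * D \<le> C * A"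
      using kernel_monoD[OF h, of x n] by (simp add: A_def C_def U_def D_def)
    have surv: "surv (Suc n) ?x1 = A + U" "surv (Suc n) ?x2 = D + C"
      by (simp_all add: surv_def step_Suc A_def C_def U_def D_def)
    \<comment> \<open>For \<open>x = 0\<close> the induction hypothesis says nothing, but the weight
      \<open>surv n 0\<close> is \<open>0\<close>.\<close>
    have "q ?x1 * surv n x * \<phi> x \<le> q ?x1 * surv n x * \<phi> ?x1"
    proof (cases x)
      case (Suc z)
      then show ?thesis
        using Suc.IH[of z] pos rates_Suc[of x]
        by (intro mult_left_mono) (auto simp: \<phi>_def)
    qed (simp add: surv_0)
    then have up: "(step ^^ Suc n) F ?x1 \<le> A * \<phi> ?x1 + U * \<phi> ?x2"
      by (simp add: step_Suc G A_def U_def algebra_simps)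
    have "p ?x2 * surv n ?x3 * \<phi> ?x2 \<le> p ?x2 * surv n ?x3 * \<phi> ?x3"
      using \<phi> pos rates_Suc[of ?x1] by (intro mult_left_mono) auto
    then have down: "D * \<phi> ?x1 + C * \<phi> ?x2 \<le> (step ^^ Suc n) F ?x2"
      by (simp add: step_Suc G D_def C_def algebra_simps)
    have "(A * \<phi> ?x1 + U * \<phi> ?x2) * (D + C) \<le> (D * \<phi> ?x1 + C * \<phi> ?x2) * (A + U)"
      using mult_nonneg_nonneg[of "C * A - U * D" "\<phi> ?x2 - \<phi> ?x1"] UD \<phi>
      by (simp add: algebra_simps)
    then have "(A * \<phi> ?x1 + U * \<phi> ?x2) / (A + U) \<le> (D * \<phi> ?x1 + C * \<phi> ?x2) / (D + C)"
      using ACUD by (simp add: divide_simps)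
    moreover have "(step ^^ Suc n) F ?x1 / (A + U) \<le> (A * \<phi> ?x1 + U * \<phi> ?x2) / (A + U)"
      using up ACUD by (intro divide_right_mono) auto
    moreover have "(D * \<phi> ?x1 + C * \<phi> ?x2) / (D + C) \<le> (step ^^ Suc n) F ?x2 / (D + C)"
      using down ACUD by (intro divide_right_mono) auto
    ultimately show ?case
      unfolding surv by linarith
  qed
  show ?thesis
  proof (intro mono_onI)
    fix x y :: nat assume "x \<in> {1..}" "x \<le> y"
    then show "(step ^^ n) F x / surv n x \<le> (step ^^ n) F y / surv n y"
      using lift_Suc_mono_le[of "\<lambda>z. (step ^^ n) F (Suc z) / surv n (Suc z)" "x - 1" "y - 1"] Suc_le
      by auto
  qed
qed

text \<open>The conditioned expectation from \<open>\<nu>\<close> is a mean of the ratios in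
  \<open>ratio_mono\<close>, with weights proportional to \<open>\<nu>(x) * surv n x\<close>, and
  the smallest ratio \<open>c\<close> is the one at \<open>1\<close>.\<close>

lemma cond_law_1_least:
  assumes h: "\<And>n. kernel_mono (surv n)" and \<nu>: "prob_on_transient \<nu>"
  shows "cond_law Q n (return_pmf 1) \<preceq>\<^sub>s\<^sub>t cond_law Q n \<nu>"
  unfolding stoch_le_def
proof (intro allI impI)
  fix f :: "nat \<Rightarrow> real"
  assume mono: "mono_on {1..} f" and bdd: "bounded (f ` {1..})"
  \<comment> \<open>The order tests \<open>f\<close> on \<open>{1..}\<close> only; setting it to
    \<open>0\<close> at \<open>0\<close> makes it compatible with absorption.\<close>
  define F where "F x = indicator {1..} x * f x" for x
  have F: "F 0 = 0" "bounded (range F)" "mono_on {1..} F"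
    using bounded_range_mult_indicator[OF bdd] mono by (auto simp: F_def[abs_def] mono_on_def)
  have trans1: "prob_on_transient (return_pmf 1)"
    by (simp add: prob_on_transient_def)
  have E: "measure_pmf.expectation (cond_law Q n L) f
      = measure_pmf.expectation L ((step ^^ n) F) / measure_pmf.expectation L (surv n)"
    if "prob_on_transient L" for L
    unfolding expectation_cond_law[OF that F(2,1), symmetric]
    by (rule expectation_cong_transient[OF prob_on_transient_cond_law[OF that]]) (simp add: F_def)
  define c where "c = (step ^^ n) F 1 / surv n 1"
  have le: "c * surv n x \<le> (step ^^ n) F x" for x
  proof (cases "x = 0")
    case False
    then have "c \<le> (step ^^ n) F x / surv n x"
      unfolding c_def using mono_onD[OF ratio_mono[OF h F(1,3)], of 1 x n] by simp
    then show ?thesis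
      using surv_pos[of x n] False by (simp add: pos_le_divide_eq)
  qed (simp add: surv_0 steps_0 F)
  have "c * measure_pmf.expectation \<nu> (surv n) = measure_pmf.expectation \<nu> (\<lambda>x. c * surv n x)"
    by simp
  also have "\<dots> \<le> measure_pmf.expectation \<nu> ((step ^^ n) F)"
    using le by (intro integral_mono integrable_mult_right integrable_pmf_bounded bounded_surv
        bounded_steps F)
  finally have "c \<le> measure_pmf.expectation \<nu> ((step ^^ n) F) / measure_pmf.expectation \<nu> (surv n)"
    using expectation_surv_pos[OF \<nu>, of n] by (simp add: pos_le_divide_eq)
  then show "measure_pmf.expectation (cond_law Q n (return_pmf 1)) f
      \<le> measure_pmf.expectation (cond_law Q n \<nu>) f"
    unfolding E[OF \<nu>] E[OF trans1] by (simp add: c_def)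
qed

section \<open>Survival probability and the three-term recurrence\<close>

text \<open>Absorption in one step is possible from \<open>1\<close> only, so survival probability
  and mass at \<open>1\<close> determine each other.\<close>

lemma survival_eq:
  assumes "prob_on_transient \<nu>"
  shows "survival Q \<nu> = 1 - q 1 * pmf \<nu> 1"
proof -
  have "pmf (law_at Q 1 \<nu>) 0 = measure_pmf.expectation \<nu> (step (indicator {0}))"
    unfolding expectation_indicator_pmf[symmetric]
    by (subst expectation_law_at) (auto intro: bounded_range_indicator)
  also have "\<dots> = measure_pmf.expectation \<nu> (\<lambda>x. q 1 * indicator {1} x)"
  proof (rule expectation_cong_transient[OF assms])
    fix x :: nat assume "x \<ge> 1"
    then obtain z where "x = Suc z"
      by (cases x) auto
    then show "step (indicator {0}) x = q 1 * indicator {1} x"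
      by (simp add: step_Suc split: split_indicator)
  qed
  also have "\<dots> = q 1 * pmf \<nu> 1"
    by (simp add: measure_pmf_single)
  finally show ?thesis
    by (simp add: survival_def)
qed

text \<open>The paths lost at step \<open>n + 1\<close> sit at \<open>1\<close> at time
  \<open>n\<close>. This ties the decay of \<open>surv n 1\<close> to the conditioned mass at
  \<open>1\<close>.\<close>

lemma surv_Suc: "surv (Suc n) x = surv n x - q 1 * (step ^^ n) (indicator {1}) x"
proof (induction n arbitrary: x)
  case 0
  show ?case
  proof (cases x)
    case (Suc z)
    then show ?thesis
      using rates_Suc(4)[of z] by (auto simp: surv_def step_Suc split: split_indicator)
  qed (simp add: surv_def step_0)
next
  case (Suc n)
  show ?case
  proof (cases x)
    case 0
    then show ?thesis
      by (simp add: surv_0 steps_0 step_0)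
  next
    case (Suc z)
    have "surv (Suc (Suc n)) x = step (surv (Suc n)) x" "surv (Suc n) x = step (surv n) x"
      by (simp_all add: surv_def)
    then show ?thesis
      by (simp add: Suc step_Suc Suc.IH algebra_simps)
  qed
qed

lemma survival_pos: "survival Q \<nu> > 0" if "prob_on_transient \<nu>"
proof -
  have "q 1 * pmf \<nu> 1 \<le> q 1"
    using rates(3)[of 1] by (simp add: mult_left_le pmf_le_1)
  moreover have "q 1 < 1"
    using rates[of 1] by linarith
  ultimately show ?thesis
    by (simp add: survival_eq that)
qed

lemma expectation_surv_1:
  assumes "prob_on_transient \<nu>"
  shows "measure_pmf.expectation \<nu> (surv 1) = survival Q \<nu>"
proof -
  have "measure_pmf.expectation \<nu> (surv 1) = measure_pmf.expectation \<nu> (\<lambda>x. 1 - q 1 * indicator {1} x)"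
    using assms surv_Suc[of 0] by (intro expectation_cong_transient) (auto simp: surv_def)
  also have "\<dots> = 1 - q 1 * pmf \<nu> 1"
    by (subst Bochner_Integration.integral_diff)
      (auto simp: measure_pmf_single intro!: integrable_mult_right integrable_pmf_bounded bounded_range_indicator)
  finally show ?thesis
    by (simp add: survival_eq assms)
qed

lemma pmf_cond_law_1:
  assumes "p 0 = 0" "prob_on_transient \<nu>"
  shows "pmf (cond_law Q 1 \<nu>) (Suc z) = (p z * pmf \<nu> z + r (Suc z) * pmf \<nu> (Suc z)
    + q (Suc (Suc z)) * pmf \<nu> (Suc (Suc z))) / survival Q \<nu>"
proof -
  have "measure_pmf.expectation \<nu> (step (indicator {Suc z}))
      = measure_pmf.expectation \<nu> (\<lambda>x. p z * indicator {z} x + r (Suc z) * indicator {Suc z} x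
          + q (Suc (Suc z)) * indicator {Suc (Suc z)} x)"
  proof (rule expectation_cong_transient[OF assms(2)])
    fix x :: nat assume "x \<ge> 1"
    then obtain w where "x = Suc w"
      by (cases x) auto
    then show "step (indicator {Suc z}) x = p z * indicator {z} x + r (Suc z) * indicator {Suc z} x
          + q (Suc (Suc z)) * indicator {Suc (Suc z)} x"
      by (auto simp: step_Suc split: split_indicator)
  qed
  also have "\<dots> = p z * pmf \<nu> z + r (Suc z) * pmf \<nu> (Suc z) + q (Suc (Suc z)) * pmf \<nu> (Suc (Suc z))"
    by (simp add: measure_pmf_single integrable_pmf_bounded bounded_range_indicator)
  finally show ?thesis
    using pmf_cond_law_eq[OF assms(2), of "Suc z" 1]
    by (simp add: expectation_surv_1[OF assms(2), simplified])
qed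

text \<open>The fixed-point equation at \<open>y + 1\<close> can be solved for the mass at
  \<open>y + 2\<close>, since \<open>q\<close> is positive there. The initial masses agree:
  \<open>0\<close> at state \<open>0\<close>, and at \<open>1\<close> the value given by the
  survival probability.\<close>

lemma quasi_stationary_unique:
  assumes "p 0 = 0" "quasi_stationary Q \<mu>" "quasi_stationary Q \<nu>" "survival Q \<mu> = survival Q \<nu>"
  shows "\<mu> = \<nu>"
proof -
  have trans: "prob_on_transient \<mu>" "prob_on_transient \<nu>"
    using assms by (auto simp: quasi_stationary_def)
  have rec: "survival Q L * pmf L (Suc z) = p z * pmf L z + r (Suc z) * pmf L (Suc z)
      + q (Suc (Suc z)) * pmf L (Suc (Suc z))" if "quasi_stationary Q L" for L z
  proof -
    have L: "prob_on_transient L" "cond_law Q 1 L = L"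
      using that by (auto simp: quasi_stationary_def)
    show ?thesis
      using pmf_cond_law_1[OF assms(1) L(1), of z] survival_pos[OF L(1)]
      unfolding L(2) by (simp add: field_simps)
  qed
  have "pmf \<mu> y = pmf \<nu> y \<and> pmf \<mu> (Suc y) = pmf \<nu> (Suc y)" for y
  proof (induction y)
    case 0
    show ?case
      using assms(4) rates(3)[of 1] by (simp add: survival_eq trans pmf_0_transient)
  next
    case (Suc y)
    have "q (Suc (Suc y)) * pmf \<mu> (Suc (Suc y)) = q (Suc (Suc y)) * pmf \<nu> (Suc (Suc y))"
      using rec[OF assms(2), of y] rec[OF assms(3), of y]
      unfolding assms(4) Suc.IH[THEN conjunct1] Suc.IH[THEN conjunct2] by linarith
    then show ?case
      using Suc rates_Suc(3)[of "Suc y"] by simp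
  qed
  then show ?thesis
    by (intro pmf_eqI) blast
qed

section \<open>Ratio limits and the Yaglom limit from every state\<close>

text \<open>
  The Karlin--McGregor polynomial: \<open>growth a x\<close> is the limit of \<open>surv n x / surv n 1\<close> when
  \<open>surv (n + 1) 1 / surv n 1\<close> tends to \<open>a\<close>.
\<close>

fun growth :: "real \<Rightarrow> nat \<Rightarrow> real" where
  "growth a 0 = 0"
| "growth a (Suc 0) = 1"
| "growth a (Suc (Suc x)) = ((a - r (Suc x)) * growth a (Suc x) - q (Suc x) * growth a x) / p (Suc x)"

text \<open>Solved for the state \<open>x + 2\<close>, \<open>step_Suc\<close> uses the states
  \<open>x\<close> and \<open>x + 1\<close>, the latter also at time \<open>n + 1\<close>. That time
  shift costs a factor tending to \<open>a\<close>, and \<open>growth a\<close> obeys the limiting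
  recurrence.\<close>

lemma ratio_limit:
  assumes a: "(\<lambda>n. surv (Suc n) 1 / surv n 1) \<longlonglongrightarrow> a"
    and L: "(\<lambda>n. (step ^^ n) F 1 / surv n 1) \<longlonglongrightarrow> L" and F: "F 0 = 0"
  shows "(\<lambda>n. (step ^^ n) F x / surv n 1) \<longlonglongrightarrow> growth a x * L"
proof -
  let ?A = "\<lambda>n x. (step ^^ n) F x / surv n 1"
  have "(\<lambda>n. ?A n x) \<longlonglongrightarrow> growth a x * L \<and> (\<lambda>n. ?A n (Suc x)) \<longlonglongrightarrow> growth a (Suc x) * L"
  proof (induction x)
    case 0
    show ?case
      using L by (simp add: steps_0 F)
  next
    case (Suc x)
    have p: "p (Suc x) > 0"
      by (rule rates_Suc)
    have "?A n (Suc (Suc x)) = (?A (Suc n) (Suc x) * (surv (Suc n) 1 / surv n 1)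
        - r (Suc x) * ?A n (Suc x) - q (Suc x) * ?A n x) / p (Suc x)" for n
    proof -
      have "surv n 1 > 0" "surv (Suc n) 1 > 0"
        by (rule surv_pos, simp)+
      then show ?thesis
        using p by (simp add: step_Suc field_simps)
    qed
    moreover have "(\<lambda>n. (?A (Suc n) (Suc x) * (surv (Suc n) 1 / surv n 1)
        - r (Suc x) * ?A n (Suc x) - q (Suc x) * ?A n x) / p (Suc x))
      \<longlonglongrightarrow> (growth a (Suc x) * L * a - r (Suc x) * (growth a (Suc x) * L)
        - q (Suc x) * (growth a x * L)) / p (Suc x)"
      using Suc p by (intro tendsto_intros a LIMSEQ_Suc[of "\<lambda>n. ?A n (Suc x)"]) auto
    moreover have "(growth a (Suc x) * L * a - r (Suc x) * (growth a (Suc x) * L)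
        - q (Suc x) * (growth a x * L)) / p (Suc x) = growth a (Suc (Suc x)) * L"
      using p by (simp add: field_simps)
    ultimately show ?case
      using Suc by simp
  qed
  then show ?thesis ..
qed

lemma surv_ratio_limit:
  assumes a: "(\<lambda>n. surv (Suc n) 1 / surv n 1) \<longlonglongrightarrow> a"
  shows "(\<lambda>n. surv n x / surv n 1) \<longlonglongrightarrow> growth a x"
proof -
  have "surv n 1 / surv n 1 = 1" for n
    using surv_pos[of 1 n] by simp
  then show ?thesis
    using ratio_limit[OF a, of "indicator {1..}" 1 x] unfolding surv_def[symmetric] by simp
qed

text \<open>A limit of positive ratios could be \<open>0\<close>. Strictness comes from the paths
  that first step down: \<open>surv (n + 1)\<close> at \<open>x + 2\<close> is at least
  \<open>q (x + 2)\<close> times \<open>surv n\<close> at \<open>x + 1\<close>.\<close>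

lemma growth_pos:
  assumes a: "(\<lambda>n. surv (Suc n) 1 / surv n 1) \<longlonglongrightarrow> a" "a > 0"
  shows "growth a (Suc x) > 0"
proof (induction x)
  case (Suc x)
  have s: "surv n 1 > 0" for n
    by (rule surv_pos) simp
  note lim = surv_ratio_limit[OF a(1)]
  have "q (Suc (Suc x)) * growth a (Suc x) \<le> growth a (Suc (Suc x)) * a"
  proof (rule LIMSEQ_le)
    show "(\<lambda>n. q (Suc (Suc x)) * (surv n (Suc x) / surv n 1)) \<longlonglongrightarrow> q (Suc (Suc x)) * growth a (Suc x)"
      by (intro tendsto_intros lim)
    show "(\<lambda>n. surv (Suc n) (Suc (Suc x)) / surv (Suc n) 1 * (surv (Suc n) 1 / surv n 1))
        \<longlonglongrightarrow> growth a (Suc (Suc x)) * a"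
      by (intro tendsto_intros a LIMSEQ_Suc[OF lim])
    have "q (Suc (Suc x)) * (surv n (Suc x) / surv n 1)
        \<le> surv (Suc n) (Suc (Suc x)) / surv (Suc n) 1 * (surv (Suc n) 1 / surv n 1)" for n
    proof -
      have "surv n (Suc (Suc x)) > 0" "surv n (Suc (Suc (Suc x))) > 0"
        by (rule surv_pos, simp)+
      then have "q (Suc (Suc x)) * surv n (Suc x) \<le> surv (Suc n) (Suc (Suc x))"
        using rates_Suc[of "Suc x"] by (simp add: surv_def step_Suc)
      then have "q (Suc (Suc x)) * surv n (Suc x) / surv n 1 \<le> surv (Suc n) (Suc (Suc x)) / surv n 1"
        using s[of n] by (intro divide_right_mono) auto
      then show ?thesis
        using s[of n] s[of "Suc n"] by simp
    qed
    then show "\<exists>N. \<forall>n\<ge>N. q (Suc (Suc x)) * (surv n (Suc x) / surv n 1)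
        \<le> surv (Suc n) (Suc (Suc x)) / surv (Suc n) 1 * (surv (Suc n) 1 / surv n 1)"
      by blast
  qed
  moreover have "q (Suc (Suc x)) * growth a (Suc x) > 0"
    using rates_Suc[of "Suc x"] Suc.IH by simp
  ultimately have "growth a (Suc (Suc x)) * a > 0"
    by linarith
  then show ?case
    using a(2) by (rule zero_less_mult_pos2)
qed simp

text \<open>Divided by \<open>surv n 1\<close>, numerator and denominator of the conditioned mass
  tend to \<open>c * pmf \<mu> y\<close> and \<open>c\<close>, and the positive factor
  \<open>c\<close> cancels.\<close>

lemma yaglom_limit_all:
  assumes lim: "yaglom_limit Q (return_pmf 1) \<mu>" and x: "x \<ge> 1"
  shows "yaglom_limit Q (return_pmf x) \<mu>"
proof -
  have trans: "prob_on_transient (return_pmf y)" if "y \<ge> 1" for y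
    using that by (simp add: prob_on_transient_def)
  have \<mu>: "prob_on_transient \<mu>"
    using lim by (simp add: yaglom_limit_def)
  have s: "surv n y > 0" if "y \<ge> 1" for n y
    using that by (rule surv_pos)
  have pmf: "pmf (cond_law Q n (return_pmf x)) y = (step ^^ n) (indicator {y}) x / surv n x"
    if "y \<ge> 1" "x \<ge> 1" for n x y
    using pmf_cond_law_eq[OF trans[OF that(2)] that(1)] by simp
  have L: "(\<lambda>n. (step ^^ n) (indicator {y}) 1 / surv n 1) \<longlonglongrightarrow> pmf \<mu> y" if "y \<ge> 1" for y
    using lim that unfolding yaglom_limit_def by (simp add: pmf)
  \<comment> \<open>The decay ratio is a function of the conditioned mass at \<open>1\<close>, so
    the assumed Yaglom limit yields its limit.\<close>
  have "surv (Suc n) 1 / surv n 1 = 1 - q 1 * ((step ^^ n) (indicator {1}) 1 / surv n 1)" for n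
    using s[of 1 n] by (simp add: surv_Suc field_simps)
  moreover have "(\<lambda>n. 1 - q 1 * ((step ^^ n) (indicator {1}) 1 / surv n 1)) \<longlonglongrightarrow> survival Q \<mu>"
    unfolding survival_eq[OF \<mu>] by (intro tendsto_intros L) simp
  ultimately have a: "(\<lambda>n. surv (Suc n) 1 / surv n 1) \<longlonglongrightarrow> survival Q \<mu>"
    by simp
  define c where "c = growth (survival Q \<mu>) x"
  have c: "c > 0"
    unfolding c_def using growth_pos[OF a survival_pos[OF \<mu>], of "x - 1"] x by simp
  have surv_lim: "(\<lambda>n. surv n x / surv n 1) \<longlonglongrightarrow> c"
    unfolding c_def by (rule surv_ratio_limit[OF a])
  have "(\<lambda>n. pmf (cond_law Q n (return_pmf x)) y) \<longlonglongrightarrow> pmf \<mu> y" if y: "y \<ge> 1" for y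
  proof -
    have "(\<lambda>n. ((step ^^ n) (indicator {y}) x / surv n 1) / (surv n x / surv n 1))
        \<longlonglongrightarrow> (c * pmf \<mu> y) / c"
      using ratio_limit[OF a L[OF y], of x] y c
      by (intro tendsto_divide surv_lim) (auto simp: c_def)
    moreover have "((step ^^ n) (indicator {y}) x / surv n 1) / (surv n x / surv n 1)
        = pmf (cond_law Q n (return_pmf x)) y" for n
      unfolding pmf[OF y x] using s[of 1 n] by simp
    ultimately show ?thesis
      using c by simp
  qed
  then show ?thesis
    using \<mu> by (simp add: yaglom_limit_def)
qed

end

section \<open>Monotonicity from the bridge hypotheses, and minimality\<close>

text \<open>The fractions are the probabilities that a two-step bridge between states in
  \<open>{y-1, y}\<close> has midpoint at least \<open>y\<close>; \<open>bridge1\<close> and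
  \<open>bridge2\<close> order them along both endpoints. \<open>last_step1\<close> and
  \<open>last_step\<close> give \<open>kernel_mono (surv 0)\<close>.\<close>

locale monotone_bridges = absorbed_birth_death +
  assumes p_0: "p 0 = 0"
    and bridge1: "\<And>y. y \<ge> 2 \<Longrightarrow>
      p (y-1) * q y / ((r (y-1))^2 + p (y-1) * q y + q (y-1) * p (y-2))
        \<le> r y * q y / (q y * r (y-1) + r y * q y) \<and>
      r y * q y / (q y * r (y-1) + r y * q y)
        \<le> ((r y)^2 + p y * q (y+1)) / ((r y)^2 + p y * q (y+1) + q y * p (y-1))"
    and bridge2: "\<And>y. y \<ge> 2 \<Longrightarrow>
      p (y-1) * q y / ((r (y-1))^2 + p (y-1) * q y + q (y-1) * p (y-2))
        \<le> p (y-1) * r y / (p (y-1) * r y + r (y-1) * p (y-1)) \<and>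
      p (y-1) * r y / (p (y-1) * r y + r (y-1) * p (y-1))
        \<le> ((r y)^2 + p y * q (y+1)) / ((r y)^2 + p y * q (y+1) + q y * p (y-1))"
    and last_step1: "p 1 / (p 1 + r 1) \<le> r 2 + p 2"
    and last_step: "\<And>y. y \<ge> 3 \<Longrightarrow> p (y-1) \<le> p y + r y"
begin

lemma p_nonneg: "p x \<ge> 0"
  using rates(1)[of x] p_0 by (cases x) auto

text \<open>Comparing the kernel of \<open>step g\<close> at \<open>x + 1\<close> and
  \<open>x + 2\<close> uses that of \<open>g\<close> across the gap below (\<open>K0\<close>) and
  the gap above (\<open>K2\<close>).\<close>

lemma kernel_mono_step:
  assumes mono: "kernel_mono g" and g0: "g 0 = 0" and g_pos: "\<And>x. x \<ge> 1 \<Longrightarrow> g x > 0"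
  shows "kernel_mono (step g)"
  unfolding kernel_mono_def
proof
  fix x
  let ?x1 = "Suc x" let ?x2 = "Suc ?x1" let ?x3 = "Suc ?x2"
  let ?h = "step g"
  have rt: "p ?x1 > 0" "r ?x1 > 0" "q ?x1 > 0" "p ?x2 > 0" "r ?x2 > 0" "q ?x2 > 0" "q ?x3 > 0"
    by (rule rates_Suc)+
  have g_nonneg: "g y \<ge> 0" for y
    using g_pos[of y] g0 by (cases y) auto
  have h_pos: "?h (Suc y) > 0" for y
    using rates_Suc[of y] g_nonneg[of y] g_pos[of "Suc y"] g_nonneg[of "Suc (Suc y)"]
    unfolding step_Suc by (intro add_pos_nonneg[OF add_nonneg_pos]) auto
  have h_nonneg: "?h y \<ge> 0" for y
    using h_pos[of "y - 1"] step_0[of g] g0 by (cases y) auto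
  define B0 where "B0 = p ?x1 * q ?x2 / (r ?x1^2 + p ?x1 * q ?x2 + q ?x1 * p x)"
  define B1 where "B1 = p ?x1 * r ?x2 / (p ?x1 * r ?x2 + r ?x1 * p ?x1)"
  define C0 where "C0 = r ?x2 * q ?x2 / (q ?x2 * r ?x1 + r ?x2 * q ?x2)"
  define C1 where "C1 = (r ?x2^2 + p ?x2 * q ?x3) / (r ?x2^2 + p ?x2 * q ?x3 + q ?x2 * p ?x1)"
  have den: "r ?x1^2 + p ?x1 * q ?x2 + q ?x1 * p x > 0" "p ?x1 * r ?x2 + r ?x1 * p ?x1 > 0"
    "q ?x2 * r ?x1 + r ?x2 * q ?x2 > 0" "r ?x2^2 + p ?x2 * q ?x3 + q ?x2 * p ?x1 > 0"
    using rt p_nonneg[of x] by (auto intro!: add_pos_nonneg)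
  \<comment> \<open>This is \<open>kernel_mono\<close> with the common terms restored on both sides;
    for \<open>x = 0\<close> both sides are \<open>0\<close>.\<close>
  have K0: "p x * g ?x1 * ?h ?x1 \<le> (r ?x1 * g ?x1 + p ?x1 * g ?x2) * ?h x"
  proof (cases x)
    case 0
    then show ?thesis
      by (simp add: p_0 step_0 g0)
  next
    case (Suc w)
    show ?thesis
      using kernel_monoD[OF mono, of w] by (simp add: Suc step_Suc algebra_simps)
  qed
  have K2: "q ?x3 * g ?x2 * ?h ?x2 \<le> (q ?x2 * g ?x1 + r ?x2 * g ?x2) * ?h ?x3"
    using kernel_monoD[OF mono, of ?x1] by (simp add: step_Suc algebra_simps)
  show "p ?x1 * ?h ?x2 * (q ?x2 * ?h ?x1)
      \<le> (r ?x2 * ?h ?x2 + p ?x2 * ?h ?x3) * (q ?x1 * ?h x + r ?x1 * ?h ?x1)"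
  proof (rule heat_bath_comparison[where ?B0.0 = B0 and ?B1.0 = B1 and ?C0.0 = C0 and ?C1.0 = C1,
        OF _ _ _ _ _ _ _ _ _ _ _ _ _ _ _ _ _ _ _ _ _ _ _ _ K0 K2])
    show "B0 \<le> C0" "C0 \<le> C1" "B0 \<le> B1" "B1 \<le> C1"
      using bridge1[of ?x2] bridge2[of ?x2] by (auto simp: B0_def B1_def C0_def C1_def)
    show "B0 < 1" "C1 \<le> 1"
      using den rt p_nonneg[of x] by (auto simp: B0_def C1_def add_pos_nonneg)
    show "0 \<le> B0" "0 < C0"
      using den rt by (auto simp: B0_def C0_def)
  qed (use rt den h_pos h_nonneg g_pos in
    \<open>auto simp: B0_def B1_def C0_def C1_def less_imp_neq[THEN not_sym] less_imp_le\<close>)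
qed

lemma kernel_mono_surv: "kernel_mono (surv n)"
proof (induction n)
  case 0
  \<comment> \<open>On \<open>{1..}\<close> the function \<open>surv 0\<close> is \<open>1\<close>.
    With \<open>s = p + r\<close> at \<open>x + 2\<close>, the claim
    \<open>p (1 - s) \<le> s (1 - p)\<close> amounts to \<open>p \<le> s\<close>.\<close>
  have *: "p (Suc x) * q (Suc (Suc x)) \<le> (r (Suc (Suc x)) + p (Suc (Suc x))) * (1 - p (Suc x))"
    if "x \<ge> 1" for x
  proof -
    have "p (Suc x) \<le> p (Suc (Suc x)) + r (Suc (Suc x))"
      using last_step[of "Suc (Suc x)"] that by simp
    then show ?thesis
      using rates_Suc(4)[of "Suc x"] by (simp add: algebra_simps) (smt (verit) distrib_left mult_cancel_left1)
  qed
  \<comment> \<open>At state \<open>1\<close> the term with \<open>q 1\<close> is lost, as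
    \<open>surv 0 0 = 0\<close>; hence the separate condition \<open>last_step1\<close>.\<close>
  have **: "p 1 * q 2 \<le> (r 2 + p 2) * r 1"
  proof -
    have "p 1 \<le> (r 2 + p 2) * (p 1 + r 1)"
      using last_step1 rates[of 1] by (simp add: pos_divide_le_eq)
    moreover have "r 2 + p 2 = 1 - q 2"
      using rates(4)[of 2] by simp
    ultimately show ?thesis
      by (simp only:) (simp add: algebra_simps)
  qed
  show ?case
    unfolding kernel_mono_def
  proof
    fix x
    show "p (Suc x) * surv 0 (Suc (Suc x)) * (q (Suc (Suc x)) * surv 0 (Suc x))
    \<le> (r (Suc (Suc x)) * surv 0 (Suc (Suc x)) + p (Suc (Suc x)) * surv 0 (Suc (Suc (Suc x))))
      * (q (Suc x) * surv 0 x + r (Suc x) * surv 0 (Suc x))"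
    proof (cases "x = 0")
      case True
      then show ?thesis
        using ** by (simp add: surv_def numeral_2_eq_2)
    next
      case False
      then show ?thesis
        using *[of x] rates_Suc(4)[of x] by (simp add: surv_def add_diff_eq[symmetric] eq_diff_eq[symmetric])
    qed
  qed
next
  case (Suc n)
  have "surv (Suc n) = step (surv n)"
    by (simp add: surv_def)
  then show ?case
    using kernel_mono_step[OF Suc surv_0 surv_pos] by simp
qed

text \<open>The laws from \<open>1\<close> increase and stay below every quasi-stationary law, so
  they converge; the limit is a fixed point by continuity and inherits the bounds.\<close>

lemma minimal_quasi_stationary:
  assumes "\<exists>\<nu>. quasi_stationary Q \<nu>"
  obtains \<mu> where "yaglom_limit Q (return_pmf 1) \<mu>" "quasi_stationary Q \<mu>"
    "\<And>\<nu>. quasi_stationary Q \<nu> \<Longrightarrow> \<mu> \<preceq>\<^sub>s\<^sub>t \<nu>"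
proof -
  define \<mu> where "\<mu> n = cond_law Q n (return_pmf 1)" for n
  have trans1: "prob_on_transient (return_pmf 1)"
    by (simp add: prob_on_transient_def)
  have trans: "prob_on_transient (\<mu> n)" for n
    unfolding \<mu>_def by (rule prob_on_transient_cond_law[OF trans1])
  have Suc: "\<mu> (Suc n) = cond_law Q 1 (\<mu> n)" for n
    using cond_law_add[OF trans1, of 1 n] by (simp add: \<mu>_def)
  have inc: "\<mu> n \<preceq>\<^sub>s\<^sub>t \<mu> (Suc n)" for n
    \<comment> \<open>The law at time \<open>n + 1\<close> is the law at time \<open>n\<close> of
      the chain started from \<open>cond_law Q 1 (return_pmf 1)\<close>.\<close>
    using cond_law_1_least[OF kernel_mono_surv prob_on_transient_cond_law[OF trans1], of n 1]
    unfolding cond_law_add[OF trans1] by (simp add: \<mu>_def)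
  have bound: "\<mu> n \<preceq>\<^sub>s\<^sub>t \<nu>" if "quasi_stationary Q \<nu>" for n \<nu>
    using cond_law_1_least[OF kernel_mono_surv, of \<nu> n] that
    by (simp add: \<mu>_def cond_law_quasi_stationary quasi_stationary_def[of Q \<nu>])
  obtain \<mu>' where \<mu>': "prob_on_transient \<mu>'" "\<And>y. (\<lambda>n. pmf (\<mu> n) y) \<longlonglongrightarrow> pmf \<mu>' y"
    using stoch_increasing_convergent[of \<mu>, OF trans inc] bound assms by metis
  have "\<mu>' = cond_law Q 1 \<mu>'"
  proof (rule pmf_eqI_transient[OF \<mu>'(1) prob_on_transient_cond_law[OF \<mu>'(1)]])
    fix y :: nat assume "y \<ge> 1"
    then obtain z where y: "y = Suc z"
      by (cases y) auto
    \<comment> \<open>Survival probability and each mass after one step depend on finitely many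
      masses, so pointwise convergence suffices.\<close>
    have "(\<lambda>n. survival Q (\<mu> n)) \<longlonglongrightarrow> survival Q \<mu>'"
      unfolding survival_eq[OF trans] survival_eq[OF \<mu>'(1)] by (intro tendsto_intros \<mu>')
    then have "(\<lambda>n. pmf (\<mu> (Suc n)) (Suc z)) \<longlonglongrightarrow> pmf (cond_law Q 1 \<mu>') (Suc z)"
      unfolding Suc pmf_cond_law_1[OF p_0 trans] pmf_cond_law_1[OF p_0 \<mu>'(1)]
      using survival_pos[OF \<mu>'(1)] by (intro tendsto_intros \<mu>') auto
    then show "pmf \<mu>' y = pmf (cond_law Q 1 \<mu>') y"
      unfolding y using LIMSEQ_Suc[OF \<mu>'(2)] LIMSEQ_unique by blast
  qed
  then have qsd: "quasi_stationary Q \<mu>'"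
    using \<mu>'(1) by (simp add: quasi_stationary_def)
  have "yaglom_limit Q (return_pmf 1) \<mu>'"
    using \<mu>' by (simp add: yaglom_limit_def \<mu>_def)
  moreover have "\<mu>' \<preceq>\<^sub>s\<^sub>t \<nu>" if "quasi_stationary Q \<nu>" for \<nu>
    using stoch_le_limit[OF \<mu>'(2) bound[OF that] \<mu>'(1)] that by (simp add: quasi_stationary_def)
  ultimately show ?thesis
    using that qsd by blast
qed

text \<open>The smallest law has the largest mass at \<open>1\<close>, hence the least survival
  probability, and that value determines a quasi-stationary law.\<close>

lemma minimal_qsd_iff:
  assumes qsd: "quasi_stationary Q \<mu>" and least: "\<And>\<nu>. quasi_stationary Q \<nu> \<Longrightarrow> \<mu> \<preceq>\<^sub>s\<^sub>t \<nu>"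
  shows "minimal_qsd Q \<nu> \<longleftrightarrow> \<nu> = \<mu>"
proof -
  have le: "survival Q \<mu> \<le> survival Q \<nu>" if \<nu>: "quasi_stationary Q \<nu>" for \<nu>
  proof -
    have trans: "prob_on_transient \<mu>" "prob_on_transient \<nu>"
      using qsd \<nu> by (auto simp: quasi_stationary_def)
    have "pmf \<nu> 1 \<le> pmf \<mu> 1"
      using stoch_le_tail[OF least[OF \<nu>], of 2] trans
      by (simp add: measure_pmf_atLeast_nat numeral_2_eq_2 pmf_0_transient)
    then show ?thesis
      using rates(3)[of 1] by (simp add: survival_eq trans)
  qed
  have "min_survival Q = survival Q \<mu>"
    unfolding min_survival_def using qsd le by (intro cInf_eq_minimum) auto
  then show ?thesis
    using quasi_stationary_unique[OF p_0, of \<nu> \<mu>] qsd by (auto simp: minimal_qsd_def)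
qed

end

theorem corollary6:
  fixes p q r :: "nat \<Rightarrow> real" and Q :: "nat \<Rightarrow> nat pmf"
  assumes chain: "birth_death_chain q r p Q"
    and p0: "p 0 = 0"
    and ex_qsd: "\<exists>\<nu>. quasi_stationary Q \<nu>"
    and ineq1: "\<And>y. y \<ge> 2 \<Longrightarrow>
      p (y-1) * q y / ((r (y-1))^2 + p (y-1) * q y + q (y-1) * p (y-2))
        \<le> r y * q y / (q y * r (y-1) + r y * q y) \<and>
      r y * q y / (q y * r (y-1) + r y * q y)
        \<le> ((r y)^2 + p y * q (y+1)) / ((r y)^2 + p y * q (y+1) + q y * p (y-1))"
    and ineq2: "\<And>y. y \<ge> 2 \<Longrightarrow>
      p (y-1) * q y / ((r (y-1))^2 + p (y-1) * q y + q (y-1) * p (y-2))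
        \<le> p (y-1) * r y / (p (y-1) * r y + r (y-1) * p (y-1)) \<and>
      p (y-1) * r y / (p (y-1) * r y + r (y-1) * p (y-1))
        \<le> ((r y)^2 + p y * q (y+1)) / ((r y)^2 + p y * q (y+1) + q y * p (y-1))"
    and ineq3: "p 1 / (p 1 + r 1) \<le> r 2 + p 2"
    and ineq4: "\<And>y. y \<ge> 3 \<Longrightarrow> p (y-1) \<le> p y + r y"
  shows "(\<forall>n. cond_law Q n (return_pmf 1) \<preceq>\<^sub>s\<^sub>t cond_law Q (n+1) (return_pmf 1)) \<and>
    (\<forall>\<nu> n. prob_on_transient \<nu> \<longrightarrow> cond_law Q n (return_pmf 1) \<preceq>\<^sub>s\<^sub>t cond_law Q n \<nu>) \<and>
    (\<forall>\<nu> n. quasi_stationary Q \<nu> \<longrightarrow> cond_law Q n (return_pmf 1) \<preceq>\<^sub>s\<^sub>t \<nu>) \<and>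
    (\<exists>\<nu>0. yaglom_limit Q (return_pmf 1) \<nu>0 \<and>
       quasi_stationary Q \<nu>0 \<and>
       (\<forall>\<nu>. quasi_stationary Q \<nu> \<longrightarrow> \<nu>0 \<preceq>\<^sub>s\<^sub>t \<nu>) \<and>
       (\<forall>\<nu>. minimal_qsd Q \<nu> \<longleftrightarrow> \<nu> = \<nu>0) \<and>
       (\<forall>x\<ge>1. yaglom_limit Q (return_pmf x) \<nu>0))"
proof -
  interpret monotone_bridges q r p Q
    by unfold_locales fact+
  have trans1: "prob_on_transient (return_pmf 1)"
    by (simp add: prob_on_transient_def)
  have least: "cond_law Q n (return_pmf 1) \<preceq>\<^sub>s\<^sub>t cond_law Q n \<nu>" if "prob_on_transient \<nu>" for n \<nu>
    by (rule cond_law_1_least[OF kernel_mono_surv that])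
  \<comment> \<open>Monotonicity in time and the bound by quasi-stationary laws are both instances
    of \<open>least\<close>: started from the law after one conditioned step, and from a fixed
    point.\<close>
  have "cond_law Q n (return_pmf 1) \<preceq>\<^sub>s\<^sub>t cond_law Q (n+1) (return_pmf 1)" for n
    using least[OF prob_on_transient_cond_law[OF trans1], of n 1]
    unfolding cond_law_add[OF trans1] by simp
  moreover have "cond_law Q n (return_pmf 1) \<preceq>\<^sub>s\<^sub>t \<nu>" if "quasi_stationary Q \<nu>" for n \<nu>
    using least[of \<nu> n] that
    by (simp add: cond_law_quasi_stationary quasi_stationary_def[of Q \<nu>])
  moreover obtain \<mu> where \<mu>: "yaglom_limit Q (return_pmf 1) \<mu>" "quasi_stationary Q \<mu>"
    "\<And>\<nu>. quasi_stationary Q \<nu> \<Longrightarrow> \<mu> \<preceq>\<^sub>s\<^sub>t \<nu>"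
    using minimal_quasi_stationary[OF ex_qsd] by metis
  ultimately show ?thesis
    using least minimal_qsd_iff[OF \<mu>(2,3)] yaglom_limit_all[OF \<mu>(1)] by blast
qed

end
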